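(* Let $\Delta\neq\mathbb{N}$ be a numerical semigroup with minimal system of generators $\{n_1,\dots,n_e\}$, let $d\ge2$ be an integer, and let $a\in\Delta\setminus\{0\}$ with $a+1\in\Delta$. Set $\Delta_d(a)=d\Delta\cup\bigcup_{i=1}^{d-1}(da+i+d\Delta)$, a numerical semigroup whose minimal generators are $dn_1,\dots,dn_e,da+1,\dots,da+d-1$ (in this order). Fix factorizations $a=\sum_{r=1}^e u_rn_r$ and $a+1=\sum_{r=1}^e v_rn_r$ with $u_r,v_r\in\mathbb{N}$, and let $u=(u_1,\dots,u_e,0,\dots,0)$ and $v=(v_1,\dots,v_e,0,\dots,0)$ in $\mathbb{N}^{e+d-1}$. For $1\le i\le d-1$ let $f_i\in\mathbb{N}^{e+d-1}$ be the coordinate vector corresponding to the generator $da+i$, i.e. the $(e+i)$-th standard basis vector. Let $\rho_1$ be the finite set consisting, for all $1\le i\le j\le d-1$, of the pairs $$\begin{cases}(f_i+f_j,\ u+f_{i+j}) & \text{if } i+j<d,\\ (f_i+f_j,\ u+v) & \text{if } i+j=d,\\ (f_i+f_j,\ v+f_{i+j-d}) & \text{if } i+j>d.\end{cases}$$ Let $\sigma\subseteq\mathbb{N}^e\times\mathbb{N}^e$ be a presentation of $\Delta$, and let $$\rho_2=\{((x,0),(y,0))\in\mathbb{N}^{e+d-1}\times\mathbb{N}^{e+d-1}: (x,y)\in\sigma\},$$ where $0$ denotes the zero vector in $\mathbb{N}^{d-1}$. Then $\rho_1\cup\rho_2$ is a presentation of $\Delta_d(a)$.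
   Context: $\mathbb{N}=\{0,1,2,\dots\}$. A numerical semigroup is a submonoid of $(\mathbb{N},+)$ with finite complement in $\mathbb{N}$; each has a unique minimal system of generators. If $S$ is a numerical semigroup with (ordered) minimal generators $s_1,\dots,s_p$, let $\varphi:\mathbb{N}^p\to S$, $(x_1,\dots,x_p)\mapsto x_1s_1+\cdots+x_ps_p$. The kernel congruence of $\varphi$ is $\{(x,y)\in\mathbb{N}^p\times\mathbb{N}^p:\varphi(x)=\varphi(y)\}$. A presentation of $S$ is a finite subset of $\mathbb{N}^p\times\mathbb{N}^p$ generating this congruence (i.e. the smallest monoid congruence on $\mathbb{N}^p$ containing the subset is the kernel congruence of $\varphi$). $dA=\{dx: x\in A\}$ and $k+A=\{k+x:x\in A\}$ for $A\subseteq\mathbb{N}$ and $k\in\mathbb{N}$. *)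

theory Defs
  imports Main "HOL.Hull" "HOL-Library.Function_Algebras" "HOL-Library.Set_Algebras"
begin

definition nat_submonoid :: "nat set \<Rightarrow> bool" where
  "nat_submonoid S \<longleftrightarrow> 0 \<in> S \<and> (\<forall>x\<in>S. \<forall>y\<in>S. x + y \<in> S)"

definition numerical_semigroup :: "nat set \<Rightarrow> bool" where
  "numerical_semigroup S \<longleftrightarrow> nat_submonoid S \<and> finite (- S)"

(* The list fixes the order of the generators; minimality is with respect to inclusion. *)
definition minimal_generators :: "nat set \<Rightarrow> nat list \<Rightarrow> bool" where
  "minimal_generators S ns \<longleftrightarrow>
     distinct ns \<and> nat_submonoid hull set ns = S \<and>
     (\<forall>B. B \<subset> set ns \<longrightarrow> nat_submonoid hull B \<noteq> S)"

(* The monoid N^p: sequences vanishing from index p on, with pointwise addition.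
   Coordinates are numbered from 0, so the r-th coordinate of the usual notation has index r - 1. *)
definition nvecs :: "nat \<Rightarrow> (nat \<Rightarrow> nat) set" where
  "nvecs p = {x. \<forall>k\<ge>p. x k = 0}"

definition unit_vec :: "nat \<Rightarrow> nat \<Rightarrow> nat" where
  "unit_vec m = (\<lambda>k. if k = m then 1 else 0)"

(* (x_1, ..., x_e, 0, ..., 0); in the encoding above the number of appended zeros is immaterial. *)
definition zero_extend :: "nat \<Rightarrow> (nat \<Rightarrow> nat) \<Rightarrow> nat \<Rightarrow> nat" where
  "zero_extend e x = (\<lambda>k. if k < e then x k else 0)"

(* The map phi sending a coefficient vector to the corresponding combination of ns. *)
definition lin_comb :: "nat list \<Rightarrow> (nat \<Rightarrow> nat) \<Rightarrow> nat" where
  "lin_comb ns x = (\<Sum>r<length ns. x r * ns ! r)"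

definition kernel_congruence :: "nat list \<Rightarrow> ((nat \<Rightarrow> nat) \<times> (nat \<Rightarrow> nat)) set" where
  "kernel_congruence ns =
     {(x, y). x \<in> nvecs (length ns) \<and> y \<in> nvecs (length ns) \<and> lin_comb ns x = lin_comb ns y}"

definition monoid_congruence :: "nat \<Rightarrow> ((nat \<Rightarrow> nat) \<times> (nat \<Rightarrow> nat)) set \<Rightarrow> bool" where
  "monoid_congruence p R \<longleftrightarrow>
     equiv (nvecs p) R \<and>
     (\<forall>x y x' y'. (x, y) \<in> R \<longrightarrow> (x', y') \<in> R \<longrightarrow> (x + x', y + y') \<in> R)"

(* rho is a presentation of the numerical semigroup whose ordered minimal generators are ns. *)
definition presentation :: "nat list \<Rightarrow> ((nat \<Rightarrow> nat) \<times> (nat \<Rightarrow> nat)) set \<Rightarrow> bool" where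
  "presentation ns \<rho> \<longleftrightarrow>
     finite \<rho> \<and> \<rho> \<subseteq> nvecs (length ns) \<times> nvecs (length ns) \<and>
     monoid_congruence (length ns) hull \<rho> = kernel_congruence ns"

definition Delta_d :: "nat set \<Rightarrow> nat \<Rightarrow> nat \<Rightarrow> nat set" where
  "Delta_d \<Delta> d a = (d *o \<Delta>) \<union> (\<Union>i\<in>{1..d - 1}. (d * a + i) +o (d *o \<Delta>))"

definition Delta_d_gens :: "nat list \<Rightarrow> nat \<Rightarrow> nat \<Rightarrow> nat list" where
  "Delta_d_gens ns d a = map (\<lambda>n. d * n) ns @ map (\<lambda>i. d * a + i) [1..<d]"

(* gen_vec e i is f_i, the (e + i)-th standard basis vector, for i \<ge> 1. *)
definition gen_vec :: "nat \<Rightarrow> nat \<Rightarrow> nat \<Rightarrow> nat" where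
  "gen_vec e i = unit_vec (e + i - 1)"

definition rho1 ::
  "nat \<Rightarrow> nat \<Rightarrow> (nat \<Rightarrow> nat) \<Rightarrow> (nat \<Rightarrow> nat) \<Rightarrow> ((nat \<Rightarrow> nat) \<times> (nat \<Rightarrow> nat)) set" where
  "rho1 e d u v =
     {(gen_vec e i + gen_vec e j,
       if i + j < d then u + gen_vec e (i + j)
       else if i + j = d then u + v
       else v + gen_vec e (i + j - d)) | i j. 1 \<le> i \<and> i \<le> j \<and> j \<le> d - 1}"

definition rho2 ::
  "nat \<Rightarrow> ((nat \<Rightarrow> nat) \<times> (nat \<Rightarrow> nat)) set \<Rightarrow> ((nat \<Rightarrow> nat) \<times> (nat \<Rightarrow> nat)) set" where
  "rho2 e \<sigma> = {(zero_extend e x, zero_extend e y) | x y. (x, y) \<in> \<sigma>}"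

end

theory Submission
  imports Defs
begin

text \<open>
  Modulo the relations in \<open>\<rho>\<^sub>1\<close> a sum of two new generators \<open>da+i\<close>, \<open>da+j\<close> collapses to a vector with
  at most one new generator. Hence every vector is congruent to a normal form \<open>w\<close> or \<open>w + f\<^sub>i\<close>
  with \<open>w\<close> supported on the old generators. The index \<open>i\<close> is the residue modulo \<open>d\<close> of the value,
  so two normal forms with equal value differ only in \<open>w\<close>, where the presentation of \<open>\<Delta>\<close> applies.
\<close>

section \<open>Atoms of submonoids of the natural numbers\<close>

text \<open>Every generating set contains these irreducible elements and a minimal one contains
  nothing else, so minimality becomes a condition on single elements.\<close>

definition atoms :: "nat set \<Rightarrow> nat set" where
  "atoms S = {g \<in> S. g \<noteq> 0 \<and> (\<forall>x\<in>S. \<forall>y\<in>S. g = x + y \<longrightarrow> x = 0 \<or> y = 0)}"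

lemma nat_submonoid_hull: "nat_submonoid (nat_submonoid hull G)"
  by (rule hull_in) (auto simp: nat_submonoid_def)

text \<open>The numbers that multiplication by \<open>d\<close> sends into \<open>S\<close> form a
  submonoid, so testing generators suffices.\<close>

lemma nat_submonoid_mult_hull:
  assumes "x \<in> nat_submonoid hull G" and "nat_submonoid S" and "\<And>g. g \<in> G \<Longrightarrow> d * g \<in> S"
  shows "d * x \<in> S"
proof -
  have "nat_submonoid hull G \<subseteq> {x. d * x \<in> S}"
    using assms(2,3) by (intro hull_minimal) (auto simp: nat_submonoid_def distrib_left)
  then show ?thesis using assms(1) by blast
qed

text \<open>Removing an atom \<open>g\<close> from \<open>S\<close> leaves a submonoid, so
  generators avoiding \<open>g\<close> cannot produce it.\<close>

lemma atoms_subset_generators: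
  assumes "nat_submonoid hull B = S"
  shows "atoms S \<subseteq> B"
proof
  fix g assume g: "g \<in> atoms S"
  have S: "nat_submonoid S" using nat_submonoid_hull assms by metis
  show "g \<in> B"
  proof (rule ccontr)
    assume "g \<notin> B"
    then have "B \<subseteq> S - {g}" using assms hull_subset by fastforce
    moreover have "nat_submonoid (S - {g})"
      unfolding nat_submonoid_def
    proof (intro conjI ballI)
      show "0 \<in> S - {g}" using S g by (simp add: nat_submonoid_def atoms_def)
      fix x y assume xy: "x \<in> S - {g}" "y \<in> S - {g}"
      then have "x + y \<in> S" using S by (simp add: nat_submonoid_def)
      moreover have "x + y \<noteq> g"
      proof
        assume "x + y = g"
        then have "x = 0 \<or> y = 0" using g xy unfolding atoms_def by blast
        then show False using xy \<open>x + y = g\<close> by auto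
      qed
      ultimately show "x + y \<in> S - {g}" by simp
    qed
    ultimately have "S \<subseteq> S - {g}" using assms by (metis hull_minimal)
    then show False using g by (auto simp: atoms_def)
  qed
qed

text \<open>By minimality \<open>n\<close> lies outside the submonoid \<open>?H\<close> generated by
  the other generators, while every element of \<open>S\<close> below \<open>n\<close> lies in
  \<open>?H\<close>. Two nonzero summands of \<open>n\<close> would both be below \<open>n\<close>
  and thus force \<open>n\<close> into \<open>?H\<close>.\<close>

lemma minimal_generators_subset_atoms:
  assumes "minimal_generators S ns"
  shows "set ns \<subseteq> atoms S"
proof
  fix n assume n: "n \<in> set ns"
  let ?H = "nat_submonoid hull (set ns - {n})"
  have gen: "nat_submonoid hull set ns = S"
    and min: "\<And>B. B \<subset> set ns \<Longrightarrow> nat_submonoid hull B \<noteq> S"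
    using assms by (auto simp: minimal_generators_def)
  have H: "nat_submonoid ?H" by (rule nat_submonoid_hull)
  have not_in: "n \<notin> ?H"
  proof
    assume "n \<in> ?H"
    then have "set ns \<subseteq> ?H" using hull_subset[of "set ns - {n}" nat_submonoid] by blast
    then have "S \<subseteq> ?H" using gen H by (metis hull_minimal)
    moreover have "?H \<subseteq> S" using gen by (metis hull_mono Diff_subset)
    ultimately show False using min[of "set ns - {n}"] n by blast
  qed
  \<comment> \<open>A sum with a summand that is at least \<open>n\<close> is itself at least
    \<open>n\<close>, so the set on the right is closed under addition.\<close>
  have small: "S \<subseteq> {x. x \<in> ?H \<or> n \<le> x}"
    unfolding gen[symmetric]
  proof (rule hull_minimal)
    show "set ns \<subseteq> {x. x \<in> ?H \<or> n \<le> x}"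
      using hull_subset[of "set ns - {n}" nat_submonoid] by blast
    show "nat_submonoid {x. x \<in> ?H \<or> n \<le> x}"
      using H by (fastforce simp: nat_submonoid_def)
  qed
  have "x = 0 \<or> y = 0" if "x \<in> S" "y \<in> S" "n = x + y" for x y
  proof (rule ccontr)
    assume "\<not> (x = 0 \<or> y = 0)"
    then have "x \<in> ?H" "y \<in> ?H" using small that by force+
    then show False using H that not_in by (auto simp: nat_submonoid_def)
  qed
  moreover have "n \<noteq> 0" using H not_in unfolding nat_submonoid_def by metis
  moreover have "n \<in> S" using n gen hull_subset by fastforce
  ultimately show "n \<in> atoms S" by (auto simp: atoms_def)
qed

text \<open>From right to left: any generating set contains all atoms, so no proper subset of
  \<open>set ns\<close> generates \<open>S\<close>.\<close>

lemma minimal_generators_iff: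
  "minimal_generators S ns \<longleftrightarrow>
     distinct ns \<and> nat_submonoid hull set ns = S \<and> set ns \<subseteq> atoms S"
proof
  show "distinct ns \<and> nat_submonoid hull set ns = S \<and> set ns \<subseteq> atoms S"
    if "minimal_generators S ns"
    using that minimal_generators_subset_atoms[OF that] by (simp add: minimal_generators_def)
  show "minimal_generators S ns"
    if "distinct ns \<and> nat_submonoid hull set ns = S \<and> set ns \<subseteq> atoms S"
    unfolding minimal_generators_def using that atoms_subset_generators by blast
qed

section \<open>The semigroup \<open>\<Delta>\<^sub>d(a)\<close>\<close>

text \<open>The first summand of \<^const>\<open>Delta_d\<close> is not the case \<open>i = 0\<close> of the others: it lacks the shift by \<open>d * a\<close>.\<close>

lemma Delta_d_cases:
  assumes "z \<in> Delta_d \<Delta> d a"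
  obtains (old) x where "x \<in> \<Delta>" "z = d * x"
    | (new) i x where "x \<in> \<Delta>" "1 \<le> i" "i < d" "z = d * (a + x) + i"
proof -
  consider "z \<in> d *o \<Delta>" | i where "i \<in> {1..d - 1}" "z \<in> (d * a + i) +o (d *o \<Delta>)"
    using assms unfolding Delta_d_def by blast
  then show thesis
  proof cases
    case 1
    then show ?thesis using old by (auto simp: elt_set_times_def)
  next
    case 2
    then obtain x where "x \<in> \<Delta>" "z = (d * a + i) + d * x"
      by (auto simp: elt_set_times_def elt_set_plus_def)
    moreover have "1 \<le> i" "i < d" using 2(1) by auto
    ultimately show ?thesis using new by (simp add: algebra_simps)
  qed
qed

lemma Delta_d_old: "x \<in> \<Delta> \<Longrightarrow> d * x \<in> Delta_d \<Delta> d a"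
  by (auto simp: Delta_d_def elt_set_times_def)

lemma Delta_d_new:
  assumes "x \<in> \<Delta>" "1 \<le> i" "i < d"
  shows "d * (a + x) + i \<in> Delta_d \<Delta> d a"
proof -
  have "d * (a + x) + i \<in> (d * a + i) +o (d *o \<Delta>)"
    using assms(1) by (auto simp: elt_set_times_def elt_set_plus_def algebra_simps)
  then show ?thesis using assms by (auto simp: Delta_d_def)
qed

text \<open>A sum of two shifted elements contains \<open>d * a\<close> twice. A carry from
  \<open>i + j\<close> is absorbed by turning one copy of \<open>a\<close> into
  \<open>a + 1\<close>; the three cases are those of \<open>rho1\<close>.\<close>

lemma nat_submonoid_Delta_d:
  assumes "nat_submonoid \<Delta>" "a \<in> \<Delta>" "a + 1 \<in> \<Delta>"
  shows "nat_submonoid (Delta_d \<Delta> d a)"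
proof -
  have add: "x + y \<in> \<Delta>" if "x \<in> \<Delta>" "y \<in> \<Delta>" for x y
    using assms(1) that by (auto simp: nat_submonoid_def)
  have "0 \<in> Delta_d \<Delta> d a"
    using Delta_d_old[of 0] assms(1) by (simp add: nat_submonoid_def)
  moreover have "z + z' \<in> Delta_d \<Delta> d a"
    if z: "z \<in> Delta_d \<Delta> d a" and z': "z' \<in> Delta_d \<Delta> d a" for z z'
    using z
  proof (cases rule: Delta_d_cases)
    case (old x)
    note x = old
    show ?thesis using z'
    proof (cases rule: Delta_d_cases)
      case (old y)
      then show ?thesis using x Delta_d_old[OF add[of x y]] by (simp add: algebra_simps)
    next
      case (new j y)
      then show ?thesis using x Delta_d_new[OF add[of x y], of j d a] by (simp add: algebra_simps)
    qed
  next
    case (new i x)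
    note x = new
    show ?thesis using z'
    proof (cases rule: Delta_d_cases)
      case (old y)
      then show ?thesis using x Delta_d_new[OF add[of x y], of i d a] by (simp add: algebra_simps)
    next
      case (new j y)
      consider "i + j < d" | "i + j = d" | "i + j > d" by linarith
      then show ?thesis
      proof cases
        case 1
        then show ?thesis
          using x new Delta_d_new[of "a + (x + y)" \<Delta> "i + j" d a] add assms(2)
          by (simp add: algebra_simps)
      next
        case 2
        \<comment> \<open>Rewriting \<open>d\<close> as \<open>i + j\<close> makes this a polynomial
          identity.\<close>
        have "z + z' = d * (a + ((a + 1) + (x + y)))"
          using x new unfolding 2[symmetric] by (simp add: algebra_simps)
        moreover have "a + ((a + 1) + (x + y)) \<in> \<Delta>" using x new add assms(2,3) by blast
        ultimately show ?thesis using Delta_d_old by metis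
      next
        case 3
        have "z + z' = d * (a + ((a + 1) + (x + y))) + (i + j - d)"
          using x new 3 by (simp add: algebra_simps)
        moreover have "(a + 1) + (x + y) \<in> \<Delta>" using x new add assms(3) by blast
        moreover have "1 \<le> i + j - d" "i + j - d < d" using x new 3 by linarith+
        ultimately show ?thesis using Delta_d_new by metis
      qed
    qed
  qed
  ultimately show ?thesis by (auto simp: nat_submonoid_def)
qed

lemma finite_Compl_nat_iff: "finite (- S) \<longleftrightarrow> (\<exists>N. \<forall>n\<ge>N. n \<in> S)" for S :: "nat set"
  by (metis Compl_iff finite_nat_set_iff_bounded not_le)

text \<open>For \<open>n \<ge> d * (a + N)\<close> both \<open>n div d\<close> and
  \<open>n div d - a\<close> are at least \<open>N\<close>, hence in \<Delta>. The first handles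
  residue 0, the second the other residues.\<close>

lemma numerical_semigroup_Delta_d:
  assumes "numerical_semigroup \<Delta>" "d \<ge> 1" "a \<in> \<Delta>" "a + 1 \<in> \<Delta>"
  shows "numerical_semigroup (Delta_d \<Delta> d a)"
proof -
  obtain N where N: "\<And>n. n \<ge> N \<Longrightarrow> n \<in> \<Delta>"
    using assms(1) by (auto simp: numerical_semigroup_def finite_Compl_nat_iff)
  have "n \<in> Delta_d \<Delta> d a" if n: "n \<ge> d * (a + N)" for n
  proof -
    have q: "n div d \<ge> a + N"
      using n assms(2) by (simp add: less_eq_div_iff_mult_less_eq mult.commute)
    show ?thesis
    proof (cases "n mod d = 0")
      case True
      then show ?thesis using Delta_d_old[of "n div d" \<Delta> d a] N q by auto
    next
      case False
      moreover have "a + (n div d - a) = n div d" using q by simp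
      ultimately show ?thesis
        using Delta_d_new[of "n div d - a" \<Delta> "n mod d" d a] N[of "n div d - a"] q assms(2) by simp
    qed
  qed
  then show ?thesis
    using nat_submonoid_Delta_d assms
    by (auto simp: numerical_semigroup_def finite_Compl_nat_iff)
qed

section \<open>Minimal generators of \<open>Delta_d\<close>\<close>

lemma set_Delta_d_gens:
  "set (Delta_d_gens ns d a) = (*) d ` set ns \<union> (\<lambda>i. d * a + i) ` {1..<d}"
  by (auto simp: Delta_d_gens_def)

lemma hull_Delta_d_gens:
  assumes "nat_submonoid hull set ns = \<Delta>" "a \<in> \<Delta>" "a + 1 \<in> \<Delta>"
  shows "nat_submonoid hull set (Delta_d_gens ns d a) = Delta_d \<Delta> d a"
proof (rule antisym)
  have mon: "nat_submonoid \<Delta>" unfolding assms(1)[symmetric] by (rule nat_submonoid_hull)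
  have ns: "set ns \<subseteq> \<Delta>" unfolding assms(1)[symmetric] by (rule hull_subset)
  have "0 \<in> \<Delta>" using mon by (simp add: nat_submonoid_def)
  then have "d * a + i \<in> Delta_d \<Delta> d a" if "i \<in> {1..<d}" for i
    using that Delta_d_new[of 0 \<Delta> i d a] by simp
  then have "set (Delta_d_gens ns d a) \<subseteq> Delta_d \<Delta> d a"
    unfolding set_Delta_d_gens using ns Delta_d_old by (intro Un_least image_subsetI) blast+
  then show "nat_submonoid hull set (Delta_d_gens ns d a) \<subseteq> Delta_d \<Delta> d a"
    using nat_submonoid_Delta_d[OF mon assms(2,3)] by (rule hull_minimal)
next
  let ?H = "nat_submonoid hull set (Delta_d_gens ns d a)"
  have H: "nat_submonoid ?H" by (rule nat_submonoid_hull)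
  have G: "set (Delta_d_gens ns d a) \<subseteq> ?H" by (rule hull_subset)
  have old_in_H: "d * x \<in> ?H" if "x \<in> \<Delta>" for x
    using that[folded assms(1)] H
    by (rule nat_submonoid_mult_hull) (use G in \<open>auto simp: set_Delta_d_gens\<close>)
  show "Delta_d \<Delta> d a \<subseteq> ?H"
  proof
    fix z assume "z \<in> Delta_d \<Delta> d a"
    then show "z \<in> ?H"
    proof (cases rule: Delta_d_cases)
      case (old x)
      then show ?thesis using old_in_H by simp
    next
      case (new i x)
      have "d * a + i \<in> ?H" using G new by (auto simp: set_Delta_d_gens)
      moreover have "z = (d * a + i) + d * x" using new by (simp add: algebra_simps)
      ultimately show ?thesis using H old_in_H[OF new(1)] by (simp add: nat_submonoid_def)
    qed
  qed
qed

text \<open>Residues modulo \<open>d\<close> exclude a decomposition with exactly one shifted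
  summand. Two unshifted summands decompose \<open>n\<close> in \<Delta>; two shifted ones would
  split \<open>n\<close> into \<open>a\<close> and a second nonzero element of \<Delta>.\<close>

lemma mult_atom_in_atoms_Delta_d:
  assumes "nat_submonoid \<Delta>" "a \<in> \<Delta>" "a \<noteq> 0" "a + 1 \<in> \<Delta>" "d \<ge> 1" and n: "n \<in> atoms \<Delta>"
  shows "d * n \<in> atoms (Delta_d \<Delta> d a)"
proof -
  have add: "x + y \<in> \<Delta>" if "x \<in> \<Delta>" "y \<in> \<Delta>" for x y
    using assms(1) that by (auto simp: nat_submonoid_def)
  have atom: "x = 0 \<or> y = 0" if "x \<in> \<Delta>" "y \<in> \<Delta>" "n = x + y" for x y
    using n that by (auto simp: atoms_def)
  have "z = 0 \<or> z' = 0"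
    if z: "z \<in> Delta_d \<Delta> d a" and z': "z' \<in> Delta_d \<Delta> d a" and eq: "d * n = z + z'" for z z'
    using z
  proof (cases rule: Delta_d_cases)
    case (old x)
    note x = old
    show ?thesis using z'
    proof (cases rule: Delta_d_cases)
      case (old y)
      then have "d * n = d * (x + y)" using x eq by (simp add: algebra_simps)
      then show ?thesis using atom[of x y] x old assms(5) by auto
    next
      case (new j y)
      then have "d * n = d * (x + a + y) + j" using x eq by (simp add: algebra_simps)
      then have "(d * n) mod d = j" using new by simp
      then show ?thesis using new by simp
    qed
  next
    case (new i x)
    note x = new
    show ?thesis using z'
    proof (cases rule: Delta_d_cases)
      case (old y)
      then have "d * n = d * (x + a + y) + i" using x eq by (simp add: algebra_simps)
      then have "(d * n) mod d = i" using x by simp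
      then show ?thesis using x by simp
    next
      case (new j y)
      have *: "d * n = d * (a + a + x + y) + (i + j)" using x new eq by (simp add: algebra_simps)
      then have "d dvd i + j" by (metis dvd_add_right_iff dvd_triv_left)
      then obtain k where k: "i + j = d * k" by (rule dvdE)
      \<comment> \<open>Both residues lie strictly between 0 and \<open>d\<close>, so
        \<open>d\<close> is the only possible multiple.\<close>
      have "d * 0 < d * k" "d * k < d * 2" using k x new by linarith+
      then have "k = 1" by simp
      then have "i + j = d" using k by simp
      then have "d * n = d * (a + (a + 1 + (x + y)))" using * by (simp add: algebra_simps)
      then have "n = a + (a + 1 + (x + y))" using assms(5) by (metis mult_cancel1 not_one_le_zero)
      moreover have "a + 1 + (x + y) \<in> \<Delta>" using x new add assms(4) by blast
      \<comment> \<open>Neither summand is zero, so this case is contradictory.\<close>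
      ultimately show ?thesis using atom[of a "a + 1 + (x + y)"] assms(2,3) by simp
    qed
  qed
  moreover have "d * n \<in> Delta_d \<Delta> d a" "d * n \<noteq> 0"
    using n assms(5) by (auto simp: atoms_def intro: Delta_d_old)
  ultimately show ?thesis by (auto simp: atoms_def)
qed

text \<open>Elements not divisible by \<open>d\<close> exceed \<open>d * a\<close>, so two of them
  sum to more than \<open>d * a + d\<close>, as \<open>a\<close> is nonzero. Hence one summand is a
  multiple of \<open>d\<close>; the other then has residue \<open>i\<close>, is at least
  \<open>d * a + i\<close>, and leaves 0 for the first.\<close>

lemma new_generator_in_atoms_Delta_d:
  assumes "0 \<in> \<Delta>" "a \<noteq> 0" "1 \<le> i" "i < d"
  shows "d * a + i \<in> atoms (Delta_d \<Delta> d a)"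
proof -
  have large: "z > d * a" if "z \<in> Delta_d \<Delta> d a" "\<not> d dvd z" for z
    using that(1) by (cases rule: Delta_d_cases) (use that(2) in \<open>auto simp: algebra_simps\<close>)
  have *: "x = 0" if "d * a + i = d * x + z" "z \<in> Delta_d \<Delta> d a" for x z
    using that(2)
  proof (cases rule: Delta_d_cases)
    case (old y)
    then have "d * a + i = d * (x + y)" using that by (simp add: algebra_simps)
    then have "(d * a + i) mod d = 0" by simp
    then show ?thesis using assms by simp
  next
    case (new j y)
    then have eq: "d * a + i = d * (x + a + y) + j" using that by (simp add: algebra_simps)
    then have "(d * a + i) mod d = (d * (x + a + y) + j) mod d" by simp
    then have "i = j" using new assms by simp
    then show ?thesis using eq assms by simp
  qed
  have "z = 0 \<or> z' = 0"
    if z: "z \<in> Delta_d \<Delta> d a" "z' \<in> Delta_d \<Delta> d a" and eq: "d * a + i = z + z'" for z z'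
  proof -
    have "d \<le> d * a" using assms(2) by simp
    then have "d dvd z \<or> d dvd z'" using large[of z] large[of z'] z eq assms(4) by linarith
    then show ?thesis
    proof
      assume "d dvd z"
      then show ?thesis using *[of _ z'] z eq by (auto elim!: dvdE)
    next
      assume "d dvd z'"
      then show ?thesis using *[of _ z] z eq by (auto elim!: dvdE simp: add.commute)
    qed
  qed
  moreover have "d * a + i \<in> Delta_d \<Delta> d a"
    using Delta_d_new[of 0 \<Delta> i d a] assms by simp
  ultimately show ?thesis using assms by (auto simp: atoms_def)
qed

lemma minimal_generators_Delta_d:
  assumes "minimal_generators \<Delta> ns" "d \<ge> 1" "a \<in> \<Delta>" "a \<noteq> 0" "a + 1 \<in> \<Delta>"
  shows "minimal_generators (Delta_d \<Delta> d a) (Delta_d_gens ns d a)"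
proof -
  have dist: "distinct ns" and gen: "nat_submonoid hull set ns = \<Delta>" and at: "set ns \<subseteq> atoms \<Delta>"
    using assms(1) by (auto simp: minimal_generators_iff)
  have mon: "nat_submonoid \<Delta>" unfolding gen[symmetric] by (rule nat_submonoid_hull)
  have "(*) d ` set ns \<inter> (\<lambda>i. d * a + i) ` {1..<d} = {}"
  proof -
    \<comment> \<open>The residue modulo \<open>d\<close> separates old generators from new
      ones.\<close>
    have "d * n \<noteq> d * a + i" if "i \<in> {1..<d}" for n i
    proof
      assume "d * n = d * a + i"
      then have "(d * n) mod d = (d * a + i) mod d" by simp
      then show False using that by simp
    qed
    then show ?thesis by blast
  qed
  then have "distinct (Delta_d_gens ns d a)"
    using dist assms(2) by (auto simp: Delta_d_gens_def distinct_map inj_on_def)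
  moreover have "set (Delta_d_gens ns d a) \<subseteq> atoms (Delta_d \<Delta> d a)"
    unfolding set_Delta_d_gens
  proof (intro Un_least image_subsetI)
    show "d * n \<in> atoms (Delta_d \<Delta> d a)" if "n \<in> set ns" for n
      using at that mult_atom_in_atoms_Delta_d[OF mon assms(3,4,5,2)] by blast
    show "d * a + i \<in> atoms (Delta_d \<Delta> d a)" if "i \<in> {1..<d}" for i
      using mon assms(4) that by (simp add: new_generator_in_atoms_Delta_d nat_submonoid_def)
  qed
  ultimately show ?thesis
    using hull_Delta_d_gens[OF gen assms(3,5)] by (simp add: minimal_generators_iff)
qed

section \<open>Congruences and presentations\<close>

lemma nvecs_add: "x \<in> nvecs p \<Longrightarrow> y \<in> nvecs p \<Longrightarrow> x + y \<in> nvecs p"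
  by (simp add: nvecs_def)

lemma nvecs_mono: "p \<le> q \<Longrightarrow> nvecs p \<subseteq> nvecs q"
  by (auto simp: nvecs_def)

lemma zero_in_nvecs: "0 \<in> nvecs p"
  by (simp add: nvecs_def)

lemma unit_vec_in_nvecs: "m < p \<Longrightarrow> unit_vec m \<in> nvecs p"
  by (auto simp: nvecs_def unit_vec_def)

lemma zero_extend_in_nvecs: "zero_extend e x \<in> nvecs e"
  by (simp add: nvecs_def zero_extend_def)

lemma zero_extend_nvecs: "x \<in> nvecs e \<Longrightarrow> zero_extend e x = x"
  by (auto simp: nvecs_def zero_extend_def)

lemma gen_vec_in_nvecs: "1 \<le> i \<Longrightarrow> e + i \<le> p \<Longrightarrow> gen_vec e i \<in> nvecs p"
  unfolding gen_vec_def by (rule unit_vec_in_nvecs) simp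

text \<open>Induction on the coordinate sum. It allows a vector to be brought to normal form one
  generator at a time.\<close>

lemma nvecs_induct [consumes 1, case_names zero add]:
  assumes "x \<in> nvecs p" "P 0"
    and step: "\<And>x m. x \<in> nvecs p \<Longrightarrow> m < p \<Longrightarrow> P x \<Longrightarrow> P (x + unit_vec m)"
  shows "P x"
  using assms(1)
proof (induction "\<Sum>k<p. x k" arbitrary: x)
  case 0
  then have "x k = 0" for k by (cases "k < p") (auto simp: nvecs_def)
  then have "x = 0" by (simp add: fun_eq_iff)
  then show ?case using assms(2) by (simp only:)
next
  case (Suc n)
  then obtain m where m: "m < p" "x m \<noteq> 0"
    by (metis nat.distinct(1) sum.neutral lessThan_iff)
  define y where "y = (\<lambda>k. if k = m then x k - 1 else x k)"
  have x: "x = y + unit_vec m" using m by (auto simp: y_def unit_vec_def)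
  have y: "y \<in> nvecs p" using Suc.prems by (auto simp: y_def nvecs_def)
  have "(\<Sum>k<p. x k) = (\<Sum>k<p. y k) + (\<Sum>k<p. unit_vec m k)"
    unfolding x by (simp add: sum.distrib)
  moreover have "(\<Sum>k<p. unit_vec m k) = 1" using m by (simp add: unit_vec_def)
  ultimately have "n = (\<Sum>k<p. y k)" using Suc.hyps by simp
  then show ?case using Suc.hyps(1) y step[OF y m(1)] x by simp
qed

lemma lin_comb_add: "lin_comb ns (x + y) = lin_comb ns x + lin_comb ns y"
  by (simp add: lin_comb_def sum.distrib distrib_right)

lemma lin_comb_unit_vec: "m < length ns \<Longrightarrow> lin_comb ns (unit_vec m) = ns ! m"
  by (simp add: lin_comb_def unit_vec_def if_distrib[of "\<lambda>c. c * _"] sum.delta cong: if_cong)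

lemma lin_comb_zero_extend:
  "lin_comb ns (zero_extend (length ns) x) = (\<Sum>r<length ns. x r * ns ! r)"
  by (simp add: lin_comb_def zero_extend_def)

lemma length_Delta_d_gens: "length (Delta_d_gens ns d a) = length ns + (d - 1)"
  by (simp add: Delta_d_gens_def)

lemma lin_comb_Delta_d_gens_nvecs:
  assumes "x \<in> nvecs (length ns)"
  shows "lin_comb (Delta_d_gens ns d a) x = d * lin_comb ns x"
proof -
  have "lin_comb (Delta_d_gens ns d a) x = (\<Sum>r<length ns. x r * Delta_d_gens ns d a ! r)"
    unfolding lin_comb_def length_Delta_d_gens
    by (rule sum.mono_neutral_right) (use assms in \<open>auto simp: nvecs_def\<close>)
  also have "\<dots> = (\<Sum>r<length ns. d * (x r * ns ! r))"
    by (rule sum.cong) (auto simp: Delta_d_gens_def nth_append)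
  finally show ?thesis by (simp add: lin_comb_def sum_distrib_left)
qed

lemma lin_comb_gen_vec:
  assumes "1 \<le> i" "i < d"
  shows "lin_comb (Delta_d_gens ns d a) (gen_vec (length ns) i) = d * a + i"
proof -
  have "lin_comb (Delta_d_gens ns d a) (gen_vec (length ns) i)
      = Delta_d_gens ns d a ! (length ns + (i - 1))"
    using assms unfolding gen_vec_def
    by (subst lin_comb_unit_vec) (auto simp: length_Delta_d_gens)
  \<comment> \<open>The list \<open>[1..<d]\<close> starts at 1, so position \<open>i - 1\<close> of
    the second block holds \<open>d * a + i\<close>.\<close>
  also have "\<dots> = map (\<lambda>i. d * a + i) [1..<d] ! (i - 1)"
    using nth_append_length_plus[of "map (\<lambda>n. d * n) ns" _ "i - 1"]
    by (simp only: Delta_d_gens_def length_map)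
  also have "\<dots> = d * a + i" using assms by simp
  finally show ?thesis .
qed

section \<open>Monoid congruences\<close>

lemma monoid_congruence_kernel: "monoid_congruence (length ns) (kernel_congruence ns)"
  unfolding monoid_congruence_def
proof (intro conjI equivI)
  show "refl_on (nvecs (length ns)) (kernel_congruence ns)"
    by (simp add: refl_on_def kernel_congruence_def)
  show "sym (kernel_congruence ns)" by (simp add: sym_def kernel_congruence_def)
  show "trans (kernel_congruence ns)" by (simp add: trans_def kernel_congruence_def)
qed (auto simp: kernel_congruence_def lin_comb_add nvecs_add)

context
  fixes p C
  assumes C: "monoid_congruence p C"
begin

lemma congruence_refl: "x \<in> nvecs p \<Longrightarrow> (x, x) \<in> C"
  using C by (auto simp: monoid_congruence_def equiv_def refl_on_def)

lemma congruence_sym: "(x, y) \<in> C \<Longrightarrow> (y, x) \<in> C"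
  using C by (auto simp: monoid_congruence_def equiv_def sym_def)

lemma congruence_trans: "(x, y) \<in> C \<Longrightarrow> (y, z) \<in> C \<Longrightarrow> (x, z) \<in> C"
  using C unfolding monoid_congruence_def equiv_def trans_def by blast

lemma congruence_add: "(x, y) \<in> C \<Longrightarrow> (x', y') \<in> C \<Longrightarrow> (x + x', y + y') \<in> C"
  using C by (auto simp: monoid_congruence_def)

text \<open>Used to cut a congruence down to the kernel congruence, so that related vectors have
  equal value.\<close>

lemma monoid_congruence_Int:
  assumes D: "monoid_congruence p D"
  shows "monoid_congruence p (C \<inter> D)"
  using C D unfolding monoid_congruence_def equiv_def
  by (auto simp: refl_on_def intro: trans_Int sym_Int)

text \<open>In this encoding \<open>nvecs q\<close> is literally a submonoid of
  \<open>nvecs p\<close>, so restriction is plain intersection.\<close>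

lemma monoid_congruence_restrict:
  assumes "q \<le> p"
  shows "monoid_congruence q (C \<inter> nvecs q \<times> nvecs q)"
  unfolding monoid_congruence_def
proof (intro conjI equivI)
  show "C \<inter> nvecs q \<times> nvecs q \<subseteq> nvecs q \<times> nvecs q" by blast
  show "refl_on (nvecs q) (C \<inter> nvecs q \<times> nvecs q)"
    using congruence_refl nvecs_mono[OF assms] by (auto simp: refl_on_def)
  show "sym (C \<inter> nvecs q \<times> nvecs q)"
    using congruence_sym by (auto simp: sym_def)
  show "trans (C \<inter> nvecs q \<times> nvecs q)"
    using congruence_trans by (auto simp: trans_def)
qed (auto intro: congruence_add nvecs_add)

text \<open>The restriction of \<open>C\<close> to the coordinates of \<open>ns\<close> is a
  congruence containing \<sigma>, hence contains the one generated by \<sigma>.\<close>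

lemma presentation_subset_congruence:
  assumes "presentation ns \<sigma>" "length ns \<le> p" "\<sigma> \<subseteq> C"
  shows "kernel_congruence ns \<subseteq> C"
proof -
  have "monoid_congruence (length ns) hull \<sigma> \<subseteq> C \<inter> nvecs (length ns) \<times> nvecs (length ns)"
    using assms monoid_congruence_restrict by (intro hull_minimal) (auto simp: presentation_def)
  then show ?thesis using assms(1) by (auto simp: presentation_def)
qed

end

section \<open>The relations \<open>rho1\<close> and \<open>rho2\<close>\<close>

lemma rho1_memI:
  assumes "1 \<le> i" "i \<le> j" "j < d"
  shows "(gen_vec e i + gen_vec e j,
       if i + j < d then u + gen_vec e (i + j)
       else if i + j = d then u + v
       else v + gen_vec e (i + j - d)) \<in> rho1 e d u v"
  unfolding rho1_def mem_Collect_eq using assms by (intro exI[of _ i] exI[of _ j]) simp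

lemma finite_rho1: "finite (rho1 e d u v)"
proof -
  have "rho1 e d u v \<subseteq> (\<lambda>(i, j). (gen_vec e i + gen_vec e j,
       if i + j < d then u + gen_vec e (i + j)
       else if i + j = d then u + v
       else v + gen_vec e (i + j - d))) ` ({..d} \<times> {..d})"
    unfolding rho1_def by fastforce
  then show ?thesis by (rule finite_subset) simp
qed

text \<open>Vectors are sequences vanishing from index \<open>e\<close> on, so appending zeros
  changes nothing.\<close>

lemma rho2_nvecs:
  assumes "\<sigma> \<subseteq> nvecs e \<times> nvecs e"
  shows "rho2 e \<sigma> = \<sigma>"
proof -
  have "zero_extend e x = x" "zero_extend e y = y" if "(x, y) \<in> \<sigma>" for x y
    using assms that by (auto intro: zero_extend_nvecs)
  then show ?thesis by (force simp: rho2_def)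
qed

text \<open>Both sides have value \<open>2 * d * a + i + j\<close>: \<open>u\<close> contributes
  \<open>d * a\<close>, and \<open>v\<close> contributes \<open>d * a + d\<close>, which accounts
  for the carry.\<close>

lemma rho1_subset_kernel:
  assumes u: "u \<in> nvecs (length ns)" "lin_comb ns u = a"
    and v: "v \<in> nvecs (length ns)" "lin_comb ns v = a + 1"
  shows "rho1 (length ns) d u v \<subseteq> kernel_congruence (Delta_d_gens ns d a)"
proof -
  let ?e = "length ns" and ?L = "lin_comb (Delta_d_gens ns d a)"
  have L: "?L u = d * a" "?L v = d * a + d"
    using u v by (auto simp: lin_comb_Delta_d_gens_nvecs)
  have in_p: "u \<in> nvecs (?e + (d - 1))" "v \<in> nvecs (?e + (d - 1))"
    using u v nvecs_mono[of ?e "?e + (d - 1)"] by auto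
  show ?thesis
  proof (rule subrelI)
    fix x y assume "(x, y) \<in> rho1 ?e d u v"
    then obtain i j where ij: "1 \<le> i" "i \<le> j" "j < d" and x: "x = gen_vec ?e i + gen_vec ?e j"
      and y: "y = (if i + j < d then u + gen_vec ?e (i + j)
        else if i + j = d then u + v else v + gen_vec ?e (i + j - d))"
      unfolding rho1_def by fastforce
    have "x \<in> nvecs (?e + (d - 1))"
      unfolding x using ij by (intro nvecs_add gen_vec_in_nvecs) linarith+
    moreover have "y \<in> nvecs (?e + (d - 1))"
    proof -
      have "gen_vec ?e k \<in> nvecs (?e + (d - 1))" if "1 \<le> k" "k < d" for k
        using that by (intro gen_vec_in_nvecs) linarith+
      then show ?thesis unfolding y using in_p ij by (simp add: nvecs_add)
    qed
    moreover have "?L x = ?L y"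
      unfolding x y using ij by (simp add: lin_comb_add lin_comb_gen_vec L)
    ultimately show "(x, y) \<in> kernel_congruence (Delta_d_gens ns d a)"
      by (simp add: kernel_congruence_def length_Delta_d_gens)
  qed
qed

section \<open>Normal forms modulo \<open>rho1\<close>\<close>

text \<open>Index 0 means that no new generator occurs. It needs its own case because, for
  \<open>e > 0\<close>, \<open>gen_vec e 0\<close> is the unit vector of the last old coordinate.
  Thus \<open>i\<close> ranges over all residues modulo \<open>d\<close>.\<close>

definition normal_form :: "nat \<Rightarrow> nat \<Rightarrow> (nat \<Rightarrow> nat) \<Rightarrow> nat \<Rightarrow> nat" where
  "normal_form e i w = (if i = 0 then w else w + gen_vec e i)"

lemma normal_form_add: "normal_form e i (x + w) = x + normal_form e i w"
  by (simp add: normal_form_def add.assoc)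

lemma normal_form_in_nvecs:
  assumes "w \<in> nvecs e" "i < d"
  shows "normal_form e i w \<in> nvecs (e + (d - 1))"
proof -
  have "w \<in> nvecs (e + (d - 1))" using assms(1) nvecs_mono[OF le_add1] by blast
  moreover have "gen_vec e i \<in> nvecs (e + (d - 1))" if "i \<noteq> 0"
    using assms(2) that by (intro gen_vec_in_nvecs) linarith+
  ultimately show ?thesis by (auto simp: normal_form_def nvecs_add simp del: add_diff_assoc)
qed

text \<open>A single rewriting step: the right-hand sides in \<open>rho1\<close> contain at most one
  new generator, so replacing \<open>gen_vec e i + gen_vec e j\<close> restores a normal
  form.\<close>

lemma normal_form_add_gen_vec:
  assumes C: "monoid_congruence (e + (d - 1)) C" and rho: "rho1 e d u v \<subseteq> C"
    and u: "u \<in> nvecs e" and v: "v \<in> nvecs e"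
    and w: "w \<in> nvecs e" and i: "i < d" and j: "1 \<le> j" "j < d"
  shows "\<exists>w'\<in>nvecs e. \<exists>k<d. (normal_form e i w + gen_vec e j, normal_form e k w') \<in> C"
proof -
  have sub: "nvecs e \<subseteq> nvecs (e + (d - 1))" by (rule nvecs_mono) simp
  show ?thesis
  proof (cases "i = 0")
    case True
    then have "normal_form e i w + gen_vec e j = normal_form e j w"
      using j by (simp add: normal_form_def)
    moreover have "(normal_form e j w, normal_form e j w) \<in> C"
      by (rule congruence_refl[OF C normal_form_in_nvecs[OF w j(2)]])
    ultimately show ?thesis using w j by auto
  next
    case False
    let ?t = "if i + j < d then u + gen_vec e (i + j)
       else if i + j = d then u + v else v + gen_vec e (i + j - d)"
    have "(gen_vec e i + gen_vec e j, ?t) \<in> C"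
    \<comment> \<open>\<open>rho1\<close> lists only pairs with ordered indices; the other order
      follows by commutativity.\<close>
    proof (cases "i \<le> j")
      case True
      then show ?thesis using rho1_memI[of i j d e u v] rho False j by auto
    next
      case False
      then show ?thesis using rho1_memI[of j i d e u v] rho i j by (auto simp: add.commute)
    qed
    then have "(w + (gen_vec e i + gen_vec e j), w + ?t) \<in> C"
      using congruence_add[OF C] congruence_refl[OF C] w sub by blast
    moreover have "w + (gen_vec e i + gen_vec e j) = normal_form e i w + gen_vec e j"
      using False by (simp add: normal_form_def add.assoc)
    moreover have "\<exists>w'\<in>nvecs e. \<exists>k<d. w + ?t = normal_form e k w'"
    proof -
      consider "i + j < d" | "i + j = d" | "i + j > d" by linarith
      then show ?thesis
      proof cases
        case 1
        then have "w + ?t = normal_form e (i + j) (w + u)"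
          using j by (simp add: normal_form_def add.assoc)
        then show ?thesis using 1 w u nvecs_add by blast
      next
        case 2
        then have "w + ?t = normal_form e 0 (w + (u + v))"
          by (simp add: normal_form_def)
        moreover have "w + (u + v) \<in> nvecs e" by (intro nvecs_add w u v)
        moreover have "0 < d" using i by simp
        ultimately show ?thesis by blast
      next
        case 3
        then have "w + ?t = normal_form e (i + j - d) (w + v)"
          by (simp add: normal_form_def add.assoc)
        moreover have "i + j - d < d" using i j by simp
        ultimately show ?thesis using w v nvecs_add by blast
      qed
    qed
    ultimately show ?thesis by metis
  qed
qed

text \<open>Unit vectors are added one by one: an old one is absorbed into \<open>w\<close>, a new
  one triggers a rewriting step.\<close>

lemma congruent_normal_form:
  assumes C: "monoid_congruence (e + (d - 1)) C" and rho: "rho1 e d u v \<subseteq> C"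
    and u: "u \<in> nvecs e" and v: "v \<in> nvecs e" and d: "d \<ge> 1"
    and x: "x \<in> nvecs (e + (d - 1))"
  shows "\<exists>w\<in>nvecs e. \<exists>i<d. (x, normal_form e i w) \<in> C"
  using x
proof (induction rule: nvecs_induct)
  case zero
  have "(0, normal_form e 0 0) \<in> C"
    using congruence_refl[OF C zero_in_nvecs] by (simp add: normal_form_def)
  then show ?case using d zero_in_nvecs by (metis Suc_le_eq One_nat_def)
next
  case (add x m)
  then obtain w i where w: "w \<in> nvecs e" and i: "i < d" and xw: "(x, normal_form e i w) \<in> C"
    by blast
  have step: "(x + unit_vec m, normal_form e i w + unit_vec m) \<in> C"
    using congruence_add[OF C xw] congruence_refl[OF C] unit_vec_in_nvecs add.hyps by blast
  show ?case
  proof (cases "m < e")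
    case True
    have "normal_form e i w + unit_vec m = normal_form e i (unit_vec m + w)"
      by (simp only: normal_form_add add.commute[of _ "unit_vec m"])
    then show ?thesis
      using step w i True by (metis nvecs_add unit_vec_in_nvecs)
  next
    case False
    \<comment> \<open>Coordinates count from 0 but new generators from 1, hence the added 1.\<close>
    define j where "j = m - e + 1"
    have j: "1 \<le> j" "j < d" "unit_vec m = gen_vec e j"
      using False add.hyps d by (auto simp: j_def gen_vec_def)
    then show ?thesis
      using normal_form_add_gen_vec[OF C rho u v w i j(1,2)] step congruence_trans[OF C]
      by metis
  qed
qed

lemma lin_comb_normal_form:
  assumes "w \<in> nvecs (length ns)" "i < d"
  shows "lin_comb (Delta_d_gens ns d a) (normal_form (length ns) i w)
       = d * (lin_comb ns w + (if i = 0 then 0 else a)) + i"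
  using assms
  by (simp add: normal_form_def lin_comb_add lin_comb_gen_vec lin_comb_Delta_d_gens_nvecs
      distrib_left)

text \<open>The value is a multiple of \<open>d\<close> plus \<open>i\<close> with
  \<open>i < d\<close>, so uniqueness of division with remainder gives \<open>i = j\<close>. Both
  quotients then contain the same shift, 0 or \<open>a\<close>, which cancels.\<close>

lemma lin_comb_normal_form_eqD:
  assumes "w \<in> nvecs (length ns)" "i < d" "w' \<in> nvecs (length ns)" "j < d"
    and eq: "lin_comb (Delta_d_gens ns d a) (normal_form (length ns) i w)
           = lin_comb (Delta_d_gens ns d a) (normal_form (length ns) j w')"
  shows "i = j" "lin_comb ns w = lin_comb ns w'"
proof -
  let ?q = "lin_comb ns w + (if i = 0 then 0 else a)"
  let ?r = "lin_comb ns w' + (if j = 0 then 0 else a)"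
  have eq': "d * ?q + i = d * ?r + j"
    using eq assms by (simp only: lin_comb_normal_form)
  then have "(d * ?q + i) mod d = (d * ?r + j) mod d" by (rule arg_cong)
  then show ij: "i = j" using assms by simp
  then have "?q = ?r" using eq' assms(2) by simp
  then show "lin_comb ns w = lin_comb ns w'" using ij by simp
qed

text \<open>All relations preserve values, which gives one inclusion. For the other, an arbitrary
  congruence containing the relations is shown to identify vectors of equal value.\<close>

lemma presentation_Delta_d:
  assumes \<sigma>: "presentation ns \<sigma>" and d: "d \<ge> 1"
    and u: "u \<in> nvecs (length ns)" "lin_comb ns u = a"
    and v: "v \<in> nvecs (length ns)" "lin_comb ns v = a + 1"
  shows "presentation (Delta_d_gens ns d a) (rho1 (length ns) d u v \<union> rho2 (length ns) \<sigma>)"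
proof -
  let ?e = "length ns" and ?K = "kernel_congruence (Delta_d_gens ns d a)"
  let ?p = "?e + (d - 1)" and ?rho = "rho1 (length ns) d u v \<union> \<sigma>"
  have fin: "finite \<sigma>" and sub: "\<sigma> \<subseteq> nvecs ?e \<times> nvecs ?e"
    and hull: "monoid_congruence ?e hull \<sigma> = kernel_congruence ns"
    using \<sigma> by (auto simp: presentation_def)
  have rho2: "rho2 ?e \<sigma> = \<sigma>" using sub by (rule rho2_nvecs)
  have mono: "nvecs ?e \<subseteq> nvecs ?p" by (rule nvecs_mono) simp
  have K: "monoid_congruence ?p ?K"
    using monoid_congruence_kernel by (metis length_Delta_d_gens)
  have "\<sigma> \<subseteq> kernel_congruence ns" using hull hull_subset by metis
  then have "\<sigma> \<subseteq> ?K"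
    using mono by (fastforce simp: kernel_congruence_def length_Delta_d_gens
        lin_comb_Delta_d_gens_nvecs)
  then have rho_K: "?rho \<subseteq> ?K" using rho1_subset_kernel[OF u v] by blast
  then have "monoid_congruence ?p hull ?rho \<subseteq> ?K"
    using K by (rule hull_minimal)
  moreover have "?K \<subseteq> monoid_congruence ?p hull ?rho"
    unfolding hull_def
  proof (intro Inter_greatest subrelI)
    fix D x y
    assume D: "D \<in> {t. monoid_congruence ?p t \<and> ?rho \<subseteq> t}" and xy: "(x, y) \<in> ?K"
    \<comment> \<open>Inside \<open>?K\<close> a vector has the same value as its normal form, so
      the values of the normal forms of \<open>x\<close> and \<open>y\<close> can be
      compared.\<close>
    define C where "C = D \<inter> ?K"
    have C: "monoid_congruence ?p C"
      using D monoid_congruence_Int K by (auto simp: C_def)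
    have rho: "rho1 ?e d u v \<subseteq> C" "\<sigma> \<subseteq> C" using D rho_K by (auto simp: C_def)
    have x: "x \<in> nvecs ?p" and y: "y \<in> nvecs ?p"
      using xy by (auto simp: kernel_congruence_def length_Delta_d_gens)
    obtain w i where w: "w \<in> nvecs ?e" "i < d" and xw: "(x, normal_form ?e i w) \<in> C"
      using congruent_normal_form[OF C rho(1) u(1) v(1) d x] by blast
    obtain w' j where w': "w' \<in> nvecs ?e" "j < d" and yw': "(y, normal_form ?e j w') \<in> C"
      using congruent_normal_form[OF C rho(1) u(1) v(1) d y] by blast
    have "(normal_form ?e i w, normal_form ?e j w') \<in> ?K"
      using xy xw yw' congruence_trans[OF K] congruence_sym[OF K] unfolding C_def by blast
    then have eq: "i = j" "lin_comb ns w = lin_comb ns w'"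
      using lin_comb_normal_form_eqD[OF w w'] by (auto simp: kernel_congruence_def)
    then have "(w, w') \<in> kernel_congruence ns"
      using w w' by (simp add: kernel_congruence_def)
    \<comment> \<open>Here the presentation of \<Delta> enters: the old parts have equal value in
      \<Delta>.\<close>
    then have "(w, w') \<in> C"
      using presentation_subset_congruence[OF C \<sigma>] rho(2) by auto
    moreover have "(gen_vec ?e i, gen_vec ?e i) \<in> C" if "i \<noteq> 0"
      using w(2) that by (intro congruence_refl[OF C] gen_vec_in_nvecs) linarith+
    ultimately have "(normal_form ?e i w, normal_form ?e j w') \<in> C"
      using congruence_add[OF C] eq(1) by (auto simp: normal_form_def)
    then have "(x, y) \<in> C"
      using xw yw' congruence_trans[OF C] congruence_sym[OF C] by blast
    then show "(x, y) \<in> D" by (simp add: C_def)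
  qed
  ultimately have "monoid_congruence ?p hull ?rho = ?K" by blast
  moreover have "?rho \<subseteq> nvecs ?p \<times> nvecs ?p"
    using rho_K by (auto simp: kernel_congruence_def length_Delta_d_gens)
  ultimately show ?thesis
    using finite_rho1 fin by (simp add: presentation_def rho2 length_Delta_d_gens)
qed

theorem theorem3p8:
  fixes \<Delta> :: "nat set" and ns :: "nat list" and d a :: nat
    and u v :: "nat \<Rightarrow> nat"
    and \<sigma> :: "((nat \<Rightarrow> nat) \<times> (nat \<Rightarrow> nat)) set"
  defines "e \<equiv> length ns"
  assumes "numerical_semigroup \<Delta>"
    and "\<Delta> \<noteq> UNIV"
    and "minimal_generators \<Delta> ns"
    and "d \<ge> 2"
    and "a \<in> \<Delta> - {0}"
    and "a + 1 \<in> \<Delta>"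
    and "a = (\<Sum>r<e. u r * ns ! r)"
    and "a + 1 = (\<Sum>r<e. v r * ns ! r)"
    and "presentation ns \<sigma>"
  shows "numerical_semigroup (Delta_d \<Delta> d a)
    \<and> minimal_generators (Delta_d \<Delta> d a) (Delta_d_gens ns d a)
    \<and> presentation (Delta_d_gens ns d a)
        (rho1 e d (zero_extend e u) (zero_extend e v) \<union> rho2 e \<sigma>)"
proof (intro conjI)
  show "numerical_semigroup (Delta_d \<Delta> d a)"
    using assms by (intro numerical_semigroup_Delta_d) auto
  show "minimal_generators (Delta_d \<Delta> d a) (Delta_d_gens ns d a)"
    using assms by (intro minimal_generators_Delta_d) auto
  show "presentation (Delta_d_gens ns d a)
      (rho1 e d (zero_extend e u) (zero_extend e v) \<union> rho2 e \<sigma>)"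
    \<comment> \<open>Only coefficients with index below \<open>e\<close> enter the factorizations,
      so \<open>zero_extend\<close> keeps the values \<open>a\<close> and
      \<open>a + 1\<close>.\<close>
    unfolding e_def using assms
    by (intro presentation_Delta_d zero_extend_in_nvecs) (auto simp: lin_comb_zero_extend)
qed

end
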